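(* For $1\le p\le2$ and $n\ge1$, with $\frac1p+\frac1{p'}=1$, $$n^{\frac{2}{p'}}\le\gamma(\ell_p^n)\le K_G^{+}(\mathbb C)\,n^{\frac2{p'}}.$$
   Context: All Banach spaces are complex; $2/p'=0$ when $p=1$. For $E=(\mathbb C^m,\|\cdot\|)$ with dual norm $\|x\|_*=\sup\{|\sum_jx_jz_j|:\|z\|\le1\}$, $\gamma(E)$ is the infimum of all $c$ such that $\sum_{i,j}a_{ij}b_{ij}\le c\|A\|_\vee\|B\|_\vee$ for all positive semidefinite $m\times m$ matrices $A=(a_{ij})$, $B=(b_{ij})$, where $\|A\|_\vee=\sup\{|\sum a_{ij}x_i\overline{y_j}|:\|x\|_*,\|y\|_*\le1\}$ (injective norm for $E$) and $\|B\|_\vee=\sup\{|\sum b_{ij}z_i\overline{w_j}|:\|z\|,\|w\|\le1\}$ (injective norm for $E^*$). $K_G^+(\mathbb C)$ is the complex positive Grothendieck constant, $K_G^+(\mathbb C)=\sup_{n\ge1}K_G^+(\ell_\infty^n,\ell_2)$ over $\mathbb C$, where $K_G^+(\ell_\infty^n,\ell_2)=\sup\|A\otimes\mathrm{id}_{\ell_2}\|_{\ell_\infty^n\check\otimes\ell_2\to\ell_1^n\hat\otimes\ell_2}$ over positive semidefinite complex $n\times n$ matrices $A$ with $\|A\|_{\ell_\infty^n\to\ell_1^n}\le1$ ($\check\otimes$, $\hat\otimes$ the injective and projective tensor products). *)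

theory Defs
  imports "Jordan_Normal_Form.Matrix" "HOL-Library.Extended_Real"
begin

section \<open>Norms on \<open>\<complex>\<^sup>m\<close>\<close>

text \<open>A norm on \<open>\<complex>\<^sup>m\<close> is a function on \<^typ>\<open>complex vec\<close>, of which only the values on
  \<open>carrier_vec m\<close> matter.\<close>

definition lp_norm :: "real \<Rightarrow> complex vec \<Rightarrow> real" where
  "lp_norm p x = (\<Sum>i<dim_vec x. cmod (x $ i) powr p) powr (1 / p)"

definition linf_norm :: "complex vec \<Rightarrow> real" where
  "linf_norm x = (MAX i\<in>{..<dim_vec x}. cmod (x $ i))"

text \<open>Duality is with respect to the bilinear (not sesquilinear) pairing.\<close>

definition dual_norm :: "nat \<Rightarrow> (complex vec \<Rightarrow> real) \<Rightarrow> complex vec \<Rightarrow> real" where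
  "dual_norm m N x = Sup {cmod (\<Sum>j<m. x $ j * z $ j) | z. z \<in> carrier_vec m \<and> N z \<le> 1}"

section \<open>The constant \<open>\<gamma>(E)\<close>\<close>

definition psd_mat :: "nat \<Rightarrow> complex mat \<Rightarrow> bool" where
  "psd_mat m A \<longleftrightarrow> A \<in> carrier_mat m m \<and>
     (\<forall>x\<in>carrier_vec m. (A *\<^sub>v x) \<bullet>c x \<in> \<real> \<and> 0 \<le> Re ((A *\<^sub>v x) \<bullet>c x))"

text \<open>\<open>vee_norm m M A\<close> takes the supremum over the unit ball of \<open>M\<close>. Thus the injective norm of
  \<open>A\<close> for \<open>E = (\<complex>\<^sup>m, N)\<close> is \<open>vee_norm m (dual_norm m N) A\<close>, and the one for \<open>E\<^sup>*\<close> is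
  \<open>vee_norm m N A\<close>.\<close>

definition vee_norm :: "nat \<Rightarrow> (complex vec \<Rightarrow> real) \<Rightarrow> complex mat \<Rightarrow> real" where
  "vee_norm m M A = Sup {cmod (\<Sum>i<m. \<Sum>j<m. A $$ (i, j) * x $ i * cnj (y $ j)) | x y.
     x \<in> carrier_vec m \<and> y \<in> carrier_vec m \<and> M x \<le> 1 \<and> M y \<le> 1}"

text \<open>For positive semidefinite \<open>A\<close> and \<open>B\<close> the sum below is real, so taking \<^const>\<open>Re\<close> loses
  nothing. The infimum is taken in the extended reals.\<close>

definition gamma_const :: "nat \<Rightarrow> (complex vec \<Rightarrow> real) \<Rightarrow> ereal" where
  "gamma_const m N = Inf (ereal ` {c. \<forall>A B. psd_mat m A \<longrightarrow> psd_mat m B \<longrightarrow>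
     Re (\<Sum>i<m. \<Sum>j<m. A $$ (i, j) * B $$ (i, j))
       \<le> c * vee_norm m (dual_norm m N) A * vee_norm m N B})"

section \<open>The complex Hilbert space \<open>\<ell>\<^sub>2\<close>\<close>

definition ell2 :: "(nat \<Rightarrow> complex) set" where
  "ell2 = {x. summable (\<lambda>k. (cmod (x k))\<^sup>2)}"

definition ell2_norm :: "(nat \<Rightarrow> complex) \<Rightarrow> real" where
  "ell2_norm x = sqrt (\<Sum>k. (cmod (x k))\<^sup>2)"

definition ell2_dual_ball :: "((nat \<Rightarrow> complex) \<Rightarrow> complex) set" where
  "ell2_dual_ball = {\<psi>.
     (\<forall>x\<in>ell2. \<forall>y\<in>ell2. \<psi> (\<lambda>k. x k + y k) = \<psi> x + \<psi> y) \<and>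
     (\<forall>c. \<forall>x\<in>ell2. \<psi> (\<lambda>k. c * x k) = c * \<psi> x) \<and>
     (\<forall>x\<in>ell2. cmod (\<psi> x) \<le> ell2_norm x)}"

section \<open>Tensor norms on \<open>\<complex>\<^sup>n \<otimes> \<ell>\<^sub>2\<close>\<close>

text \<open>The tensor \<open>\<Sum>i<n. e\<^sub>i \<otimes> t\<^sub>i\<close> is represented by the family \<open>t :: nat \<Rightarrow> nat \<Rightarrow> complex\<close>, of
  which only the members with index below \<open>n\<close> matter. Since \<open>\<complex>\<^sup>n\<close> is finite-dimensional, the
  algebraic tensor product is already complete for the injective and the projective norm.\<close>

definition tensor_space :: "nat \<Rightarrow> (nat \<Rightarrow> nat \<Rightarrow> complex) set" where
  "tensor_space n = {t. \<forall>i<n. t i \<in> ell2}"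

definition inj_tensor_norm ::
    "nat \<Rightarrow> (complex vec \<Rightarrow> real) \<Rightarrow> (nat \<Rightarrow> nat \<Rightarrow> complex) \<Rightarrow> real" where
  "inj_tensor_norm n N t = Sup {cmod (\<Sum>i<n. \<phi> $ i * \<psi> (t i)) | \<phi> \<psi>.
     \<phi> \<in> carrier_vec n \<and> dual_norm n N \<phi> \<le> 1 \<and> \<psi> \<in> ell2_dual_ball}"

text \<open>The infimum runs over all representations \<open>t = \<Sum>k<r. u\<^sub>k \<otimes> v\<^sub>k\<close>.\<close>

definition proj_tensor_norm ::
    "nat \<Rightarrow> (complex vec \<Rightarrow> real) \<Rightarrow> (nat \<Rightarrow> nat \<Rightarrow> complex) \<Rightarrow> real" where
  "proj_tensor_norm n N t = Inf {\<Sum>k<r. N (u k) * ell2_norm (v k) | (r :: nat) u v.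
     (\<forall>k<r. u k \<in> carrier_vec n \<and> v k \<in> ell2) \<and>
     (\<forall>i<n. \<forall>l. t i l = (\<Sum>k<r. u k $ i * v k l))}"

text \<open>\<open>A \<otimes> id\<close> sends \<open>\<Sum>j. e\<^sub>j \<otimes> t\<^sub>j\<close> to \<open>\<Sum>j. A e\<^sub>j \<otimes> t\<^sub>j = \<Sum>i. e\<^sub>i \<otimes> (\<Sum>j. a\<^sub>i\<^sub>j t\<^sub>j)\<close>.\<close>

definition tensor_id :: "nat \<Rightarrow> complex mat \<Rightarrow> (nat \<Rightarrow> nat \<Rightarrow> complex) \<Rightarrow> nat \<Rightarrow> nat \<Rightarrow> complex" where
  "tensor_id n A t = (\<lambda>i l. \<Sum>j<n. A $$ (i, j) * t j l)"

definition tensor_id_opnorm :: "nat \<Rightarrow> complex mat \<Rightarrow> ereal" where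
  "tensor_id_opnorm n A =
     (SUP t\<in>{t \<in> tensor_space n. inj_tensor_norm n linf_norm t \<le> 1}.
        ereal (proj_tensor_norm n (lp_norm 1) (tensor_id n A t)))"

section \<open>The complex positive Grothendieck constant\<close>

definition opnorm_inf_1 :: "nat \<Rightarrow> complex mat \<Rightarrow> real" where
  "opnorm_inf_1 n A = Sup {lp_norm 1 (A *\<^sub>v x) | x. x \<in> carrier_vec n \<and> linf_norm x \<le> 1}"

definition KG_plus_dim :: "nat \<Rightarrow> ereal" where
  "KG_plus_dim n = (SUP A\<in>{A. psd_mat n A \<and> opnorm_inf_1 n A \<le> 1}. tensor_id_opnorm n A)"

text \<open>Suprema are taken in the extended reals, so no finiteness is presupposed.\<close>

definition KG_plus :: ereal where
  "KG_plus = (SUP n\<in>{1..}. KG_plus_dim n)"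

end

theory Submission
  imports Defs "HOL-Analysis.Convex"
begin

text \<open>Write \<open>q\<close> for the conjugate exponent of \<open>p\<close>. The unit ball of the dual of \<open>\<ell>\<^sub>p\<close> is that of \<open>\<ell>\<^sub>q\<close>,
  and \<open>p \<le> 2 \<le> q\<close>.

  For the lower bound, take \<open>A = B = I\<close>, for which \<open>\<Sum> a\<^sub>i\<^sub>j b\<^sub>i\<^sub>j = n\<close>. As a form on the ball of \<open>\<ell>\<^sub>p\<close> the
  identity has norm at most one, because \<open>\<parallel>x\<parallel>\<^sub>2 \<le> \<parallel>x\<parallel>\<^sub>p\<close>. As a form on the ball of \<open>\<ell>\<^sub>q\<close> its norm is at
  most \<open>n\<^bsup>1 - 2/q\<^esup>\<close>, by comparison of power means. The quotient is \<open>n\<^bsup>2/q\<^esup>\<close>.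

  For the upper bound, compare both matrices with the extreme case \<open>p = 1\<close>. The ball of \<open>\<ell>\<^sub>\<infinity>\<close> lies in
  \<open>n\<^bsup>1/q\<^esup>\<close> times the ball of \<open>\<ell>\<^sub>q\<close>, so the norm of \<open>A\<close> from \<open>\<ell>\<^sub>\<infinity>\<close> to \<open>\<ell>\<^sub>1\<close> is at most \<open>n\<^bsup>2/q\<^esup>\<close> times its
  injective norm (\<open>opnorm_inf_1_le_vee_norm\<close>). Of \<open>B\<close> only the diagonal matters. It is bounded by the
  injective norm of \<open>B\<close>, so \<open>B\<close> is a Gram matrix of vectors whose squared lengths are at most this norm
  (\<open>gram_decomposition\<close>). These vectors form an element \<open>t\<close> of \<open>\<ell>\<^sub>\<infinity> \<otimes> \<ell>\<^sub>2\<close>, whose injective norm is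
  their maximal length. Since \<open>\<Sum> a\<^sub>i\<^sub>j b\<^sub>i\<^sub>j\<close> is the pairing of \<open>(A \<otimes> id) t\<close> with the same vectors
  conjugated, it is at most that length times the projective norm of \<open>(A \<otimes> id) t\<close>, and the positive
  Grothendieck constant bounds the latter (\<open>trace_pairing_le_KG_plus\<close>).\<close>

section \<open>Comparison of power means\<close>

text \<open>The comparison of the \<open>\<ell>\<^sub>1\<close> and \<open>\<ell>\<^sub>s\<close> norms, by Young's inequality applied to each normalised
  entry and summed. It yields every power of \<open>n\<close> in the theorem.\<close>

lemma power_mean_inequality:
  fixes u :: "nat \<Rightarrow> real"
  assumes u: "\<And>i. i < n \<Longrightarrow> 0 \<le> u i" and s: "1 \<le> s" and n: "1 \<le> n"
  shows "(\<Sum>i<n. u i) \<le> real n powr (1 - 1 / s) * (\<Sum>i<n. u i powr s) powr (1 / s)"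
proof (cases "(\<Sum>i<n. u i powr s) = 0")
  case True
  then have "\<And>i. i < n \<Longrightarrow> u i = 0"
    by (subst (asm) sum_nonneg_eq_0_iff) auto
  then show ?thesis by simp
next
  case False
  define S where "S = (\<Sum>i<n. u i powr s)"
  have S: "S > 0" using False unfolding S_def
    by (simp add: less_le sum_nonneg)
  define D where "D = real n powr (1 - 1 / s) * S powr (1 / s)"
  have D: "D > 0" using S n by (simp add: D_def)
  have *: "u i / D \<le> (1 / s) * (u i powr s / S) + (1 - 1 / s) * (1 / n)" if i: "i < n" for i
  proof (cases "u i = 0")
    case True
    then show ?thesis using s S by simp
  next
    case False
    then have ui: "u i > 0" using u[OF i] by simp
    \<comment> \<open>Both arguments, \<open>u i powr s / S\<close> and \<open>1 / n\<close>, sum to one over the index set.\<close>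
    have "(u i powr s / S) powr (1 / s) * (1 / n) powr (1 - 1 / s)
        \<le> (1 / s) * (u i powr s / S) + (1 - 1 / s) * (1 / n)"
      using s ui S n by (intro Youngs_inequality_0) auto
    also have "(u i powr s / S) powr (1 / s) * (1 / n) powr (1 - 1 / s) = u i / D"
      using s ui S n by (simp add: D_def powr_divide powr_powr)
    finally show ?thesis .
  qed
  have "(\<Sum>i<n. u i) / D = (\<Sum>i<n. u i / D)"
    by (simp add: sum_divide_distrib)
  also have "\<dots> \<le> (\<Sum>i<n. (1 / s) * (u i powr s / S) + (1 - 1 / s) * (1 / n))"
    using * by (intro sum_mono) auto
  also have "\<dots> = (1 / s) * (S / S) + (1 - 1 / s)"
    using n by (simp add: sum.distrib S_def flip: sum_distrib_left sum_divide_distrib)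
  also have "\<dots> = 1" using S by simp
  finally show ?thesis using D by (simp add: D_def S_def field_simps)
qed

section \<open>Dual norms and injective norms as suprema over unit balls\<close>

text \<open>The only property of a norm that is needed to bound the suprema in \<^const>\<open>dual_norm\<close> and
  \<^const>\<open>vee_norm\<close>. A supremum of an unbounded set of reals has no meaning, so this has to hold
  before an element of the set can be compared with the supremum.\<close>

definition coordinatewise_bounded_ball :: "nat \<Rightarrow> (complex vec \<Rightarrow> real) \<Rightarrow> bool" where
  "coordinatewise_bounded_ball m M \<longleftrightarrow>
     (\<forall>x\<in>carrier_vec m. M x \<le> 1 \<longrightarrow> (\<forall>i<m. cmod (x $ i) \<le> 1))"

lemma lp_norm_le_1_iff:
  assumes "0 < p"
  shows "lp_norm p x \<le> 1 \<longleftrightarrow> (\<Sum>i<dim_vec x. cmod (x $ i) powr p) \<le> 1"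
proof -
  have "0 \<le> (\<Sum>i<dim_vec x. cmod (x $ i) powr p)" by (simp add: sum_nonneg)
  then show ?thesis
    using assms unfolding lp_norm_def
    by (smt (verit) divide_pos_pos powr_le1 powr_less_mono2 powr_one_eq_one)
qed

lemma lp_norm_smult:
  assumes "0 < p"
  shows "lp_norm p (c \<cdot>\<^sub>v x) = cmod c * lp_norm p x"
  using assms unfolding lp_norm_def
  by (simp add: norm_mult powr_mult sum_nonneg powr_powr flip: sum_distrib_left)

lemma lp_norm_zero: "0 < p \<Longrightarrow> lp_norm p (0\<^sub>v m) \<le> 1"
  by (simp add: lp_norm_le_1_iff)

lemma lp_norm_unit_vec:
  assumes "0 < p" "i < n"
  shows "lp_norm p (unit_vec n i) \<le> 1"
  using assms
  by (simp add: lp_norm_le_1_iff if_distrib[of cmod] if_distrib[of "\<lambda>x. x powr p"] cong: if_cong)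

lemma lp_ball_coordinatewise_bounded:
  assumes "0 < p"
  shows "coordinatewise_bounded_ball m (lp_norm p)"
  unfolding coordinatewise_bounded_ball_def
proof (intro ballI impI allI)
  fix x :: "complex vec" and i
  assume x: "x \<in> carrier_vec m" "lp_norm p x \<le> 1" "i < m"
  then have "cmod (x $ i) powr p \<le> (\<Sum>i<dim_vec x. cmod (x $ i) powr p)"
    by (intro member_le_sum) auto
  then have "cmod (x $ i) powr p \<le> 1"
    using x(2) assms by (simp add: lp_norm_le_1_iff)
  then show "cmod (x $ i) \<le> 1"
    using assms by (smt (verit) powr_less_mono2 powr_one_eq_one)
qed

lemma linf_norm_le_1_iff:
  assumes "x \<in> carrier_vec m" "1 \<le> m"
  shows "linf_norm x \<le> 1 \<longleftrightarrow> (\<forall>i<m. cmod (x $ i) \<le> 1)"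
proof -
  have "{..<m} \<noteq> {}" using assms by (auto simp: lessThan_empty_iff)
  then show ?thesis using assms unfolding linf_norm_def by auto
qed

lemma linf_norm_zero: "1 \<le> m \<Longrightarrow> linf_norm (0\<^sub>v m) \<le> 1"
  by (subst linf_norm_le_1_iff[of _ m]) auto

lemma linf_ball_coordinatewise_bounded:
  "1 \<le> m \<Longrightarrow> coordinatewise_bounded_ball m linf_norm"
  unfolding coordinatewise_bounded_ball_def using linf_norm_le_1_iff by blast

lemma dual_norm_upper:
  assumes "coordinatewise_bounded_ball m N" "z \<in> carrier_vec m" "N z \<le> 1"
  shows "cmod (\<Sum>j<m. x $ j * z $ j) \<le> dual_norm m N x"
  unfolding dual_norm_def
proof (rule cSup_upper)
  show "bdd_above {cmod (\<Sum>j<m. x $ j * z $ j) |z. z \<in> carrier_vec m \<and> N z \<le> 1}"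
  proof (rule bdd_aboveI[where M = "\<Sum>j<m. cmod (x $ j)"], clarify)
    fix z assume "z \<in> carrier_vec m" "N z \<le> 1"
    then have z: "\<And>i. i < m \<Longrightarrow> cmod (z $ i) \<le> 1"
      using assms(1) by (auto simp: coordinatewise_bounded_ball_def)
    show "cmod (\<Sum>j<m. x $ j * z $ j) \<le> (\<Sum>j<m. cmod (x $ j))"
      using z by (intro sum_norm_le) (auto simp: norm_mult intro!: mult_left_le)
  qed
qed (use assms in auto)

lemma dual_norm_le:
  assumes "\<And>z. z \<in> carrier_vec m \<Longrightarrow> N z \<le> 1 \<Longrightarrow> cmod (\<Sum>j<m. x $ j * z $ j) \<le> c"
    and "N (0\<^sub>v m) \<le> 1"
  shows "dual_norm m N x \<le> c"
  unfolding dual_norm_def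
  by (rule cSup_least) (use assms zero_carrier_vec[of m] in blast)+

lemma dual_norm_zero:
  assumes "N (0\<^sub>v m) \<le> 1"
  shows "dual_norm m N (0\<^sub>v m) \<le> 1"
  by (rule dual_norm_le) (use assms in auto)

text \<open>Pairing with the unit vectors, which lie in the unit ball of \<open>\<ell>\<^sub>p\<close>, reads off the coordinates.\<close>

lemma dual_lp_ball_coordinatewise_bounded:
  assumes "0 < p"
  shows "coordinatewise_bounded_ball m (dual_norm m (lp_norm p))"
  unfolding coordinatewise_bounded_ball_def
proof (intro ballI impI allI)
  fix x :: "complex vec" and i
  assume x: "x \<in> carrier_vec m" "dual_norm m (lp_norm p) x \<le> 1" and i: "i < m"
  have "lp_norm p (unit_vec m i) \<le> 1"
    using assms i by (rule lp_norm_unit_vec)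
  then have "cmod (\<Sum>j<m. x $ j * unit_vec m i $ j) \<le> dual_norm m (lp_norm p) x"
    by (intro dual_norm_upper lp_ball_coordinatewise_bounded) (use assms in auto)
  moreover have "(\<Sum>j<m. x $ j * unit_vec m i $ j) = (\<Sum>j<m. if j = i then x $ i else 0)"
    using i by (intro sum.cong) auto
  ultimately show "cmod (x $ i) \<le> 1" using x i by simp
qed

lemma vee_norm_upper:
  assumes "coordinatewise_bounded_ball m M"
    and "x \<in> carrier_vec m" "M x \<le> 1" "y \<in> carrier_vec m" "M y \<le> 1"
  shows "cmod (\<Sum>i<m. \<Sum>j<m. A $$ (i, j) * x $ i * cnj (y $ j)) \<le> vee_norm m M A"
  unfolding vee_norm_def
proof (rule cSup_upper)
  show "bdd_above {cmod (\<Sum>i<m. \<Sum>j<m. A $$ (i, j) * x $ i * cnj (y $ j)) |x y.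
     x \<in> carrier_vec m \<and> y \<in> carrier_vec m \<and> M x \<le> 1 \<and> M y \<le> 1}"
  proof (rule bdd_aboveI[where M = "\<Sum>i<m. \<Sum>j<m. cmod (A $$ (i, j))"], clarify)
    fix x y assume xy: "x \<in> carrier_vec m" "M x \<le> 1" "y \<in> carrier_vec m" "M y \<le> 1"
    then have b: "\<And>i. i < m \<Longrightarrow> cmod (x $ i) \<le> 1" "\<And>i. i < m \<Longrightarrow> cmod (y $ i) \<le> 1"
      using assms(1) by (auto simp: coordinatewise_bounded_ball_def)
    show "cmod (\<Sum>i<m. \<Sum>j<m. A $$ (i, j) * x $ i * cnj (y $ j))
        \<le> (\<Sum>i<m. \<Sum>j<m. cmod (A $$ (i, j)))"
      using b by (intro sum_norm_le)
        (auto simp: norm_mult mult.assoc intro!: mult_left_le mult_le_one)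
  qed
qed (use assms in blast)

lemma vee_norm_le:
  assumes "\<And>x y. \<lbrakk>x \<in> carrier_vec m; y \<in> carrier_vec m; M x \<le> 1; M y \<le> 1\<rbrakk>
      \<Longrightarrow> cmod (\<Sum>i<m. \<Sum>j<m. A $$ (i, j) * x $ i * cnj (y $ j)) \<le> c"
    and "M (0\<^sub>v m) \<le> 1"
  shows "vee_norm m M A \<le> c"
  unfolding vee_norm_def
  by (rule cSup_least) (use assms(1) assms(2) zero_carrier_vec[of m] in blast)+

lemma vee_norm_nonneg:
  assumes "coordinatewise_bounded_ball m M" "M (0\<^sub>v m) \<le> 1"
  shows "0 \<le> vee_norm m M A"
  using vee_norm_upper[OF assms(1) _ assms(2) _ assms(2), of A] by simp

lemma vee_norm_smult_le:
  assumes "coordinatewise_bounded_ball m M" "M (0\<^sub>v m) \<le> 1" "A \<in> carrier_mat m m" "0 \<le> r"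
  shows "vee_norm m M (complex_of_real r \<cdot>\<^sub>m A) \<le> r * vee_norm m M A"
proof (rule vee_norm_le)
  fix x y assume xy: "x \<in> carrier_vec m" "y \<in> carrier_vec m" "M x \<le> 1" "M y \<le> 1"
  have "(\<Sum>i<m. \<Sum>j<m. (complex_of_real r \<cdot>\<^sub>m A) $$ (i, j) * x $ i * cnj (y $ j))
      = complex_of_real r * (\<Sum>i<m. \<Sum>j<m. A $$ (i, j) * x $ i * cnj (y $ j))"
    unfolding sum_distrib_left using assms(3) by (intro sum.cong) auto
  then show "cmod (\<Sum>i<m. \<Sum>j<m. (complex_of_real r \<cdot>\<^sub>m A) $$ (i, j) * x $ i * cnj (y $ j))
      \<le> r * vee_norm m M A"
    using vee_norm_upper[OF assms(1) xy(1,3,2,4), of A] assms(4)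
    by (simp add: norm_mult mult_left_mono)
qed (rule assms(2))

section \<open>Gram decomposition of positive semidefinite matrices\<close>

definition quadratic_form :: "nat \<Rightarrow> (nat \<Rightarrow> nat \<Rightarrow> complex) \<Rightarrow> (nat \<Rightarrow> complex) \<Rightarrow> complex" where
  "quadratic_form n b x = (\<Sum>i<n. \<Sum>j<n. b i j * x j * cnj (x i))"

lemma sum_two_points:
  fixes f :: "nat \<Rightarrow> complex"
  assumes "i < n" "j < n" "i \<noteq> j" "\<And>k. k \<noteq> i \<Longrightarrow> k \<noteq> j \<Longrightarrow> f k = 0"
  shows "(\<Sum>k<n. f k) = f i + f j"
proof -
  have "(\<Sum>k<n. f k) = (\<Sum>k\<in>{i, j}. f k)"
    using assms by (intro sum.mono_neutral_right) auto
  then show ?thesis using assms by simp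
qed

lemma quadratic_form_two_points:
  assumes "i < n" "j < n" "i \<noteq> j"
  shows "quadratic_form n b (\<lambda>k. if k = i then a else if k = j then c else 0) =
    b i i * a * cnj a + b i j * c * cnj a + b j i * a * cnj c + b j j * c * cnj c"
proof -
  let ?x = "\<lambda>k. if k = i then a else if k = j then c else 0"
  have inner: "(\<Sum>l<n. b k l * ?x l * cnj (?x k)) = (b k i * a + b k j * c) * cnj (?x k)" for k
    using assms by (subst sum_two_points[OF assms]) (auto simp: algebra_simps)
  show ?thesis
    unfolding quadratic_form_def inner
    using assms by (subst sum_two_points[OF assms]) (auto simp: algebra_simps)
qed

lemma quadratic_form_unit:
  assumes "i < n"
  shows "quadratic_form n b (\<lambda>k. if k = i then 1 else 0) = b i i"
proof -
  have "quadratic_form n b (\<lambda>k. if k = i then 1 else 0)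
      = (\<Sum>k<n. if k = i then \<Sum>j<n. if j = i then b i i else 0 else 0)"
    unfolding quadratic_form_def by (intro sum.cong refl) (auto simp: if_distrib[of "\<lambda>z. _ * z"] cong: if_cong)
  then show ?thesis using assms by simp
qed

text \<open>Polarisation: over the complex numbers, a form with real values is hermitian.\<close>

lemma nonneg_form_hermitian:
  assumes pos: "\<And>x. 0 \<le> quadratic_form n b x" and ij: "i < n" "j < n"
  shows "b j i = cnj (b i j)"
proof (cases "i = j")
  case True
  have "0 \<le> b i i" using pos[of "\<lambda>k. if k = i then 1 else 0"] ij by (simp add: quadratic_form_unit)
  then show ?thesis using True by (simp add: complex_eq_iff less_eq_complex_def)
next
  case False
  have d: "0 \<le> b i i" "0 \<le> b j j"
    using pos[of "\<lambda>k. if k = i then 1 else 0"] pos[of "\<lambda>k. if k = j then 1 else 0"] ij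
    by (simp_all add: quadratic_form_unit)
  have "0 \<le> b i i + b i j + b j i + b j j"
    using pos[of "\<lambda>k. if k = i then 1 else if k = j then 1 else 0"]
    by (simp only: quadratic_form_two_points[OF ij False]) simp
  \<comment> \<open>The vector \<open>e\<^sub>i + e\<^sub>j\<close> shows that \<open>b\<^sub>i\<^sub>j + b\<^sub>j\<^sub>i\<close> is real, and \<open>e\<^sub>i + \<i> e\<^sub>j\<close> that
    \<open>\<i> (b\<^sub>i\<^sub>j - b\<^sub>j\<^sub>i)\<close> is.\<close>
  moreover have "0 \<le> b i i + b i j * \<i> - b j i * \<i> + b j j"
    using pos[of "\<lambda>k. if k = i then 1 else if k = j then \<i> else 0"]
    by (simp only: quadratic_form_two_points[OF ij False]) (simp add: mult.assoc)
  ultimately show ?thesis using d by (auto simp: complex_eq_iff less_eq_complex_def)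
qed

text \<open>Otherwise the form would take negative values on the plane spanned by \<open>e\<^sub>i\<close> and \<open>e\<^sub>j\<close>, where,
  for a fixed coefficient of \<open>e\<^sub>i\<close>, it is affine in that of \<open>e\<^sub>j\<close>.\<close>

lemma nonneg_form_zero_diagonal:
  assumes pos: "\<And>x. 0 \<le> quadratic_form n b x" and ij: "i < n" "j < n" and z: "b j j = 0"
  shows "b i j = 0"
proof (rule ccontr)
  assume nz: "b i j \<noteq> 0"
  then have False: "i \<noteq> j" using z by auto
  define r where "r = (cmod (b i j))\<^sup>2"
  have r: "r > 0" using nz by (simp add: r_def)
  \<comment> \<open>At the vector \<open>e\<^sub>i + ?c e\<^sub>j\<close> the form is \<open>b\<^sub>i\<^sub>i - 2 s r\<close>, and this \<open>s\<close> turns that into \<open>- 1\<close>.\<close>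
  define s where "s = (Re (b i i) + 1) / (2 * r)"
  let ?c = "- complex_of_real s * cnj (b i j)"
  have h: "b j i = cnj (b i j)" using pos ij by (rule nonneg_form_hermitian)
  have sq: "b i j * cnj (b i j) = complex_of_real r"
    unfolding r_def complex_norm_square ..
  have "0 \<le> b i i + b i j * ?c + b j i * cnj ?c"
    using pos[of "\<lambda>k. if k = i then 1 else if k = j then ?c else 0"]
    by (simp only: quadratic_form_two_points[OF ij False] z) simp
  also have "b i i + b i j * ?c + b j i * cnj ?c = b i i - 2 * complex_of_real s * (b i j * cnj (b i j))"
    by (simp add: h algebra_simps)
  also have "\<dots> = b i i - complex_of_real (2 * s * r)" by (simp add: sq)
  finally have "2 * s * r \<le> Re (b i i)" by (simp add: less_eq_complex_def)
  then show False using r by (simp add: s_def)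
qed

text \<open>Completing the square in the last variable. For a positive pivot \<open>b n n\<close>, the last coordinate on
  the right minimises the form. Nonnegativity thus passes to the Schur complement. If \<open>b n n = 0\<close>, both
  divisions give zero and the identity persists.\<close>

lemma quadratic_form_schur_complement:
  assumes herm: "\<And>i. i < n \<Longrightarrow> b i n = cnj (b n i)" and d: "b n n = complex_of_real d"
  shows "quadratic_form n (\<lambda>i j. b i j - b i n * b n j / b n n) x =
     quadratic_form (Suc n) b (\<lambda>k. if k < n then x k else - (\<Sum>j<n. b n j * x j) / b n n)"
proof -
  define S where "S = (\<Sum>j<n. b n j * x j)"
  have T: "(\<Sum>i<n. b i n * cnj (x i)) = cnj S"
    using herm by (simp add: S_def cnj_sum)
  have "quadratic_form n (\<lambda>i j. b i j - b i n * b n j / b n n) x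
      = quadratic_form n b x - (\<Sum>i<n. \<Sum>j<n. (b i n * cnj (x i)) * (b n j * x j)) / b n n"
    by (simp add: quadratic_form_def algebra_simps sum_subtractf sum_divide_distrib diff_divide_distrib)
  also have "(\<Sum>i<n. \<Sum>j<n. (b i n * cnj (x i)) * (b n j * x j)) = cnj S * S"
    by (simp add: T S_def[symmetric] flip: sum_distrib_left sum_distrib_right)
  finally have L: "quadratic_form n (\<lambda>i j. b i j - b i n * b n j / b n n) x
      = quadratic_form n b x - cnj S * S / b n n" .
  define y where "y = - S / b n n"
  have "quadratic_form (Suc n) b (\<lambda>k. if k < n then x k else y)
      = quadratic_form n b x + (\<Sum>i<n. b i n * cnj (x i)) * y + S * cnj y + b n n * y * cnj y"
    by (simp add: quadratic_form_def sum.distrib S_def sum_distrib_left sum_distrib_right algebra_simps)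
  also have "\<dots> = quadratic_form n b x - cnj S * S / b n n"
    unfolding T by (cases "d = 0") (simp_all add: y_def d field_simps)
  finally show ?thesis using L unfolding y_def S_def by simp
qed

text \<open>Cholesky's elimination: the Schur complement with respect to the last index is again
  nonnegative, has a Gram decomposition by induction, and differs from \<open>b\<close> by a matrix of rank one.\<close>

lemma gram_decomposition:
  assumes "\<And>x. 0 \<le> quadratic_form n b x"
  shows "\<exists>v. \<forall>i<n. \<forall>j<n. b i j = (\<Sum>k<n. v k i * cnj (v k j))"
  using assms
proof (induction n arbitrary: b)
  case 0
  then show ?case by simp
next
  case (Suc n)
  have herm: "b j i = cnj (b i j)" if "i \<le> n" "j \<le> n" for i j
    using Suc.prems that by (intro nonneg_form_hermitian[of "Suc n"]) auto
  have "0 \<le> b n n"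
    using Suc.prems[of "\<lambda>k. if k = n then 1 else 0"] by (simp add: quadratic_form_unit)
  then obtain d where d: "b n n = complex_of_real d" "0 \<le> d"
    by (metis complex_is_Real_iff less_eq_complex_def zero_complex.simps Reals_cases of_real_0 Re_complex_of_real)
  have zero: "b i n = 0" if "d = 0" "i \<le> n" for i
    using nonneg_form_zero_diagonal[of "Suc n" b i n] Suc.prems that d by simp
  have schur: "quadratic_form n (\<lambda>i j. b i j - b i n * b n j / b n n) x =
      quadratic_form (Suc n) b (\<lambda>k. if k < n then x k else - (\<Sum>j<n. b n j * x j) / b n n)" for x
    by (rule quadratic_form_schur_complement[where d = d]) (rule herm, simp_all add: d)
  have "0 \<le> quadratic_form n (\<lambda>i j. b i j - b i n * b n j / b n n) x" for x
    unfolding schur by (rule Suc.prems)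
  from Suc.IH[OF this] obtain v
    where v: "\<forall>i<n. \<forall>j<n. b i j - b i n * b n j / b n n = (\<Sum>k<n. v k i * cnj (v k j))" ..
  let ?r = "complex_of_real (sqrt d)"
  have rr: "?r * ?r = b n n" unfolding of_real_mult[symmetric] using d by simp
  \<comment> \<open>One more coordinate, which carries the last column divided by the square root of the pivot.
    When the pivot is zero, so is that column, and the convention \<open>a / 0 = 0\<close> fits.\<close>
  define w where "w k i = (if k < n then if i < n then v k i else 0
    else if i < n then b i n / ?r else ?r)" for k i
  have "b i j = (\<Sum>k<Suc n. w k i * cnj (w k j))" if ij: "i \<le> n" "j \<le> n" for i j
  proof -
    consider "i < n" "j < n" | "i < n" "j = n" | "i = n" "j < n" | "i = n" "j = n"
      using ij by linarith
    then show ?thesis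
    proof cases
      case 1
      then have "(\<Sum>k<Suc n. w k i * cnj (w k j))
          = (\<Sum>k<n. v k i * cnj (v k j)) + b i n * cnj (b j n) / (?r * ?r)"
        by (simp add: w_def)
      then show ?thesis using v 1 herm[of n j] unfolding rr by (simp add: diff_eq_eq)
    next
      case 2
      then have "(\<Sum>k<Suc n. w k i * cnj (w k j)) = b i n / ?r * ?r" by (simp add: w_def)
      then show ?thesis using zero[of i] 2 by (cases "d = 0") simp_all
    next
      case 3
      then have "(\<Sum>k<Suc n. w k i * cnj (w k j)) = ?r * (cnj (b j n) / ?r)" by (simp add: w_def)
      also have "\<dots> = cnj (b j n)" using zero[of j] 3 by (cases "d = 0") simp_all
      also have "\<dots> = b n j" using herm[of j n] 3 by simp
      finally show ?thesis using 3 by simp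
    next
      case 4
      then have "(\<Sum>k<Suc n. w k i * cnj (w k j)) = ?r * ?r" by (simp add: w_def)
      then show ?thesis using 4 by (simp only: rr)
    qed
  qed
  then show ?case unfolding less_Suc_eq_le by blast
qed

lemma psd_mat_iff_nonneg_form:
  "psd_mat n A \<longleftrightarrow> A \<in> carrier_mat n n \<and> (\<forall>x. 0 \<le> quadratic_form n (\<lambda>i j. A $$ (i, j)) x)"
proof (cases "A \<in> carrier_mat n n")
  case True
  have eq: "(A *\<^sub>v x) \<bullet>c x = quadratic_form n (\<lambda>i j. A $$ (i, j)) (\<lambda>i. x $ i)"
    if x: "x \<in> carrier_vec n" for x
    using True x unfolding quadratic_form_def
    by (auto simp: scalar_prod_def sum_distrib_right lessThan_atLeast0 intro!: sum.cong)
  have real: "z \<in> \<real> \<and> 0 \<le> Re z \<longleftrightarrow> 0 \<le> z" for z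
    by (auto simp: less_eq_complex_def complex_is_Real_iff)
  have cong: "quadratic_form n (\<lambda>i j. A $$ (i, j)) x
      = quadratic_form n (\<lambda>i j. A $$ (i, j)) (\<lambda>i. vec n x $ i)" for x
    by (simp add: quadratic_form_def)
  show ?thesis
    unfolding psd_mat_def real using True eq
    by (metis (no_types, lifting) cong vec_carrier)
qed (auto simp: psd_mat_def)

lemma psd_mat_smult:
  assumes "psd_mat n A" "0 \<le> r"
  shows "psd_mat n (complex_of_real r \<cdot>\<^sub>m A)"
proof -
  have A: "A \<in> carrier_mat n n" using assms by (simp add: psd_mat_def)
  have "quadratic_form n (\<lambda>i j. (complex_of_real r \<cdot>\<^sub>m A) $$ (i, j)) x
      = complex_of_real r * quadratic_form n (\<lambda>i j. A $$ (i, j)) x" for x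
    unfolding quadratic_form_def sum_distrib_left using A by (intro sum.cong) auto
  then show ?thesis
    using assms unfolding psd_mat_iff_nonneg_form by (simp add: less_eq_complex_def)
qed

section \<open>Tensor norms and the positive Grothendieck constant\<close>

lemma finite_support_in_ell2:
  assumes "\<And>l. m \<le> l \<Longrightarrow> x l = 0"
  shows "x \<in> ell2" and "ell2_norm x = sqrt (\<Sum>l<m. (cmod (x l))\<^sup>2)"
proof -
  show "x \<in> ell2"
    unfolding ell2_def mem_Collect_eq
    by (rule summable_finite[of "{..<m}"]) (use assms in \<open>auto simp: not_less\<close>)
  show "ell2_norm x = sqrt (\<Sum>l<m. (cmod (x l))\<^sup>2)"
    unfolding ell2_norm_def
    by (subst suminf_finite[of "{..<m}"]) (use assms in \<open>auto simp: not_less\<close>)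
qed

lemma unimodular_multipliers:
  "\<exists>s. \<forall>i. cmod (s i) \<le> 1 \<and> s i * w i = complex_of_real (cmod (w i))"
proof (intro exI allI conjI)
  fix i
  show "cmod (cnj (w i) / cmod (w i)) \<le> 1" by (simp add: norm_divide)
  have "w i * cnj (w i) = (complex_of_real (cmod (w i)))\<^sup>2"
    using complex_norm_square[of "w i"] by simp
  then show "cnj (w i) / cmod (w i) * w i = complex_of_real (cmod (w i))"
    by (simp add: power2_eq_square mult.commute)
qed

text \<open>Testing against the conjugate phases of \<open>x\<close> shows that the dual of \<open>\<ell>\<^sub>\<infinity>\<close> carries at least the
  \<open>\<ell>\<^sub>1\<close> norm.\<close>

lemma sum_cmod_le_dual_linf_norm:
  assumes "1 \<le> n"
  shows "(\<Sum>i<n. cmod (x $ i)) \<le> dual_norm n linf_norm x"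
proof -
  obtain s where s: "\<And>i. cmod (s i) \<le> 1" "\<And>i. s i * x $ i = complex_of_real (cmod (x $ i))"
    using unimodular_multipliers[of "\<lambda>i. x $ i"] by blast
  have "cmod (\<Sum>i<n. x $ i * vec n s $ i) \<le> dual_norm n linf_norm x"
    using assms s(1) by (intro dual_norm_upper linf_ball_coordinatewise_bounded) (auto simp: linf_norm_le_1_iff)
  also have "(\<Sum>i<n. x $ i * vec n s $ i) = complex_of_real (\<Sum>i<n. cmod (x $ i))"
    using s(2) by (simp add: mult.commute)
  finally show ?thesis by (simp add: sum_nonneg flip: of_real_sum)
qed

text \<open>In \<open>\<ell>\<^sub>\<infinity> \<otimes> \<ell>\<^sub>2\<close> the injective norm is the largest norm of the components.\<close>

lemma inj_tensor_norm_linf_le_1: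
  assumes n: "1 \<le> n" and t: "\<And>i. i < n \<Longrightarrow> t i \<in> ell2" "\<And>i. i < n \<Longrightarrow> ell2_norm (t i) \<le> 1"
  shows "inj_tensor_norm n linf_norm t \<le> 1"
  unfolding inj_tensor_norm_def
proof (rule cSup_least)
  have "linf_norm (0\<^sub>v n) \<le> 1" using n by (rule linf_norm_zero)
  then have "dual_norm n linf_norm (0\<^sub>v n) \<le> 1" by (rule dual_norm_zero)
  moreover have "(\<lambda>_. 0) \<in> ell2_dual_ball"
    by (auto simp: ell2_dual_ball_def ell2_norm_def ell2_def suminf_nonneg)
  ultimately show "{cmod (\<Sum>i<n. \<phi> $ i * \<psi> (t i)) |\<phi> \<psi>.
     \<phi> \<in> carrier_vec n \<and> dual_norm n linf_norm \<phi> \<le> 1 \<and> \<psi> \<in> ell2_dual_ball} \<noteq> {}"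
    using zero_carrier_vec[of n] by blast
next
  fix r assume "r \<in> {cmod (\<Sum>i<n. \<phi> $ i * \<psi> (t i)) |\<phi> \<psi>.
     \<phi> \<in> carrier_vec n \<and> dual_norm n linf_norm \<phi> \<le> 1 \<and> \<psi> \<in> ell2_dual_ball}"
  then obtain \<phi> \<psi> where r: "r = cmod (\<Sum>i<n. \<phi> $ i * \<psi> (t i))"
    and \<phi>: "dual_norm n linf_norm \<phi> \<le> 1" and \<psi>: "\<psi> \<in> ell2_dual_ball" by blast
  have "cmod (\<psi> (t i)) \<le> 1" if "i < n" for i
    using \<psi> t[OF that] unfolding ell2_dual_ball_def by (blast intro: order_trans)
  then have "r \<le> (\<Sum>i<n. cmod (\<phi> $ i))"
    unfolding r by (intro sum_norm_le) (auto simp: norm_mult intro!: mult_left_le)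
  then show "r \<le> 1" using sum_cmod_le_dual_linf_norm[OF n, of \<phi>] \<phi> by linarith
qed

lemma ell2_pairing_le_norm:
  assumes "x \<in> ell2" "(\<Sum>l<m. (cmod (w l))\<^sup>2) \<le> 1"
  shows "cmod (\<Sum>l<m. x l * w l) \<le> ell2_norm x"
proof -
  have "cmod (\<Sum>l<m. x l * w l) \<le> (\<Sum>l<m. cmod (x l) * cmod (w l))"
    by (intro sum_norm_le) (simp add: norm_mult)
  also have "\<dots> \<le> sqrt ((\<Sum>l<m. (cmod (x l))\<^sup>2) * (\<Sum>l<m. (cmod (w l))\<^sup>2))"
    by (intro real_le_rsqrt Cauchy_Schwarz_ineq_sum)
  also have "\<dots> \<le> sqrt (\<Sum>l<m. (cmod (x l))\<^sup>2)"
    using assms(2) by (intro real_sqrt_le_mono mult_left_le) (auto simp: sum_nonneg)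
  also have "\<dots> \<le> ell2_norm x"
    unfolding ell2_norm_def using assms(1)
    by (intro real_sqrt_le_mono sum_le_suminf) (auto simp: ell2_def)
  finally show ?thesis .
qed

text \<open>The dual of \<open>\<ell>\<^sub>1 \<otimes> \<ell>\<^sub>2\<close> with the projective norm consists of families of functionals on
  \<open>\<ell>\<^sub>2\<close> that are bounded in norm. A family \<open>w\<close> in its unit ball, with coordinates from \<open>m\<close> on
  zero, therefore bounds the projective norm from below.\<close>

lemma proj_tensor_norm_l1_ge:
  assumes t: "\<And>i. i < n \<Longrightarrow> t i \<in> ell2"
    and w: "\<And>i. i < n \<Longrightarrow> (\<Sum>l<m. (cmod (w i l))\<^sup>2) \<le> 1"
  shows "cmod (\<Sum>i<n. \<Sum>l<m. t i l * w i l) \<le> proj_tensor_norm n (lp_norm 1) t"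
  unfolding proj_tensor_norm_def
proof (rule cInf_greatest)
  let ?R = "{\<Sum>k<r. lp_norm 1 (u k) * ell2_norm (v k) |(r :: nat) u v.
     (\<forall>k<r. u k \<in> carrier_vec n \<and> v k \<in> ell2) \<and>
     (\<forall>i<n. \<forall>l. t i l = (\<Sum>k<r. u k $ i * v k l))}"
  \<comment> \<open>The representation \<open>\<Sum>k. e\<^sub>k \<otimes> t\<^sub>k\<close> shows that the infimum is over a nonempty set.\<close>
  have "t i l = (\<Sum>k<n. unit_vec n k $ i * t k l)" if "i < n" for i l
  proof -
    have "(\<Sum>k<n. unit_vec n k $ i * t k l) = (\<Sum>k<n. if k = i then t i l else 0)"
      using that by (intro sum.cong) auto
    then show ?thesis using that by simp
  qed
  then have "(\<Sum>k<n. lp_norm 1 (unit_vec n k) * ell2_norm (t k)) \<in> ?R"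
    using t by (intro CollectI exI[of _ n] exI[of _ "unit_vec n"] exI[of _ t]) simp
  then show "?R \<noteq> {}" by blast
  fix c assume "c \<in> ?R"
  then obtain r :: nat and u v where c: "c = (\<Sum>k<r. lp_norm 1 (u k) * ell2_norm (v k))"
    and uv: "\<forall>k<r. u k \<in> carrier_vec n \<and> v k \<in> ell2"
    and rep: "\<forall>i<n. \<forall>l. t i l = (\<Sum>k<r. u k $ i * v k l)"
    by blast
  have "(\<Sum>i<n. \<Sum>l<m. t i l * w i l) = (\<Sum>i<n. \<Sum>l<m. \<Sum>k<r. u k $ i * v k l * w i l)"
    using rep by (simp add: sum_distrib_right)
  also have "\<dots> = (\<Sum>i<n. \<Sum>k<r. \<Sum>l<m. u k $ i * v k l * w i l)"
    by (intro sum.cong refl sum.swap)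
  also have "\<dots> = (\<Sum>k<r. \<Sum>i<n. \<Sum>l<m. u k $ i * v k l * w i l)"
    by (rule sum.swap)
  also have "\<dots> = (\<Sum>k<r. \<Sum>i<n. u k $ i * (\<Sum>l<m. v k l * w i l))"
    by (simp add: sum_distrib_left mult.assoc)
  also have "cmod \<dots> \<le> c"
    unfolding c
  proof (rule sum_norm_le)
    fix k assume "k \<in> {..<r}"
    then have k: "u k \<in> carrier_vec n" "v k \<in> ell2" using uv by auto
    have "cmod (\<Sum>i<n. u k $ i * (\<Sum>l<m. v k l * w i l)) \<le> (\<Sum>i<n. cmod (u k $ i) * ell2_norm (v k))"
      using k w by (intro sum_norm_le) (auto simp: norm_mult intro!: mult_left_mono ell2_pairing_le_norm)
    also have "\<dots> = lp_norm 1 (u k) * ell2_norm (v k)"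
      using k by (simp add: lp_norm_def sum_nonneg flip: sum_distrib_right)
    finally show "cmod (\<Sum>i<n. u k $ i * (\<Sum>l<m. v k l * w i l)) \<le> lp_norm 1 (u k) * ell2_norm (v k)" .
  qed
  finally show "cmod (\<Sum>i<n. \<Sum>l<m. t i l * w i l) \<le> c" .
qed

text \<open>The link between \<open>\<gamma>\<close> and the Grothendieck constant. If \<open>B\<close> is the Gram matrix of vectors of
  norm at most one, these vectors form a tensor \<open>t\<close> in the unit ball of \<open>\<ell>\<^sub>\<infinity> \<otimes> \<ell>\<^sub>2\<close>. The sum
  \<open>\<Sum> a\<^sub>i\<^sub>j b\<^sub>i\<^sub>j\<close> pairs \<open>(A \<otimes> id) t\<close> with the same vectors conjugated, hence is at most the
  projective norm of \<open>(A \<otimes> id) t\<close>.\<close>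

lemma trace_pairing_le_KG_plus:
  assumes n: "1 \<le> n" and A: "psd_mat n A" "opnorm_inf_1 n A \<le> 1"
    and B: "psd_mat n B" "\<And>i. i < n \<Longrightarrow> Re (B $$ (i, i)) \<le> 1"
  shows "ereal (Re (\<Sum>i<n. \<Sum>j<n. A $$ (i, j) * B $$ (i, j))) \<le> KG_plus"
proof -
  obtain v where v: "\<And>i j. i < n \<Longrightarrow> j < n \<Longrightarrow> B $$ (i, j) = (\<Sum>k<n. v k i * cnj (v k j))"
    using gram_decomposition[of n "\<lambda>i j. B $$ (i, j)"] B(1) unfolding psd_mat_iff_nonneg_form by blast
  \<comment> \<open>The conjugate makes \<open>b\<^sub>i\<^sub>j\<close> the bilinear pairing of \<open>t\<^sub>j\<close> with \<open>v\<^sub>i\<close>, so that \<open>A\<close>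
    acts on the \<open>t\<^sub>j\<close> and the \<open>v\<^sub>i\<close> serve as test vectors.\<close>
  define t where "t i l = (if l < n then cnj (v l i) else 0)" for i l
  have diag: "(\<Sum>l<n. (cmod (v l i))\<^sup>2) \<le> 1" if i: "i < n" for i
  proof -
    have "B $$ (i, i) = complex_of_real (\<Sum>l<n. (cmod (v l i))\<^sup>2)"
      using v[OF i i] unfolding of_real_sum complex_norm_square .
    then show ?thesis using B(2)[OF i] by simp
  qed
  have t: "t i \<in> ell2" "ell2_norm (t i) = sqrt (\<Sum>l<n. (cmod (v l i))\<^sup>2)" for i
    using finite_support_in_ell2[of n "t i"] by (auto simp: t_def)
  have inj: "inj_tensor_norm n linf_norm t \<le> 1"
    using n diag t by (intro inj_tensor_norm_linf_le_1) auto
  have "(\<Sum>i<n. \<Sum>j<n. A $$ (i, j) * B $$ (i, j))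
      = (\<Sum>i<n. \<Sum>j<n. \<Sum>l<n. A $$ (i, j) * t j l * v l i)"
    using v by (intro sum.cong refl) (simp add: sum_distrib_left t_def mult_ac)
  also have "\<dots> = (\<Sum>i<n. \<Sum>l<n. \<Sum>j<n. A $$ (i, j) * t j l * v l i)"
    by (intro sum.cong refl sum.swap)
  also have "\<dots> = (\<Sum>i<n. \<Sum>l<n. tensor_id n A t i l * v l i)"
    by (simp add: tensor_id_def sum_distrib_right)
  finally have eq: "(\<Sum>i<n. \<Sum>j<n. A $$ (i, j) * B $$ (i, j))
      = (\<Sum>i<n. \<Sum>l<n. tensor_id n A t i l * v l i)" .
  have "tensor_id n A t i \<in> ell2" for i
    by (rule finite_support_in_ell2(1)[of n]) (simp add: tensor_id_def t_def)
  then have "cmod (\<Sum>i<n. \<Sum>l<n. tensor_id n A t i l * v l i)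
      \<le> proj_tensor_norm n (lp_norm 1) (tensor_id n A t)"
    using diag by (intro proj_tensor_norm_l1_ge) auto
  then have "ereal (Re (\<Sum>i<n. \<Sum>j<n. A $$ (i, j) * B $$ (i, j)))
      \<le> ereal (proj_tensor_norm n (lp_norm 1) (tensor_id n A t))"
    unfolding eq ereal_less_eq(3) by (rule order_trans[OF complex_Re_le_cmod])
  also have "\<dots> \<le> tensor_id_opnorm n A"
    unfolding tensor_id_opnorm_def using inj t by (intro SUP_upper) (auto simp: tensor_space_def)
  also have "\<dots> \<le> KG_plus_dim n"
    unfolding KG_plus_dim_def using A by (intro SUP_upper) auto
  also have "\<dots> \<le> KG_plus"
    unfolding KG_plus_def using n by (intro SUP_upper) auto
  finally show ?thesis .
qed

text \<open>This excludes the value \<open>-\<infinity>\<close>.\<close>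

lemma KG_plus_nonneg: "0 \<le> KG_plus"
proof -
  have psd: "psd_mat 1 (0\<^sub>m 1 1)" by (simp add: psd_mat_iff_nonneg_form quadratic_form_def)
  have "opnorm_inf_1 1 (0\<^sub>m 1 1) \<le> 1"
    unfolding opnorm_inf_1_def
  proof (rule cSup_least)
    have "linf_norm (0\<^sub>v 1) \<le> 1" by (rule linf_norm_zero) simp
    then show "{lp_norm 1 (0\<^sub>m 1 1 *\<^sub>v x) |x. x \<in> carrier_vec 1 \<and> linf_norm x \<le> 1} \<noteq> {}"
      using zero_carrier_vec[of 1] by blast
  qed (auto simp: lp_norm_def scalar_prod_def)
  from trace_pairing_le_KG_plus[OF _ psd this psd] show ?thesis by (simp add: zero_ereal_def)
qed

section \<open>The lower bound\<close>

lemma one_mat_form: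
  "(\<Sum>i<n. \<Sum>j<n. 1\<^sub>m n $$ (i, j) * x i * y j) = (\<Sum>i<n. x i * (y i :: complex))"
proof (rule sum.cong[OF refl])
  fix i assume "i \<in> {..<n}"
  then have "(\<Sum>j<n. 1\<^sub>m n $$ (i, j) * x i * y j) = (\<Sum>j<n. if j = i then x i * y i else 0)"
    by (intro sum.cong) auto
  then show "(\<Sum>j<n. 1\<^sub>m n $$ (i, j) * x i * y j) = x i * y i"
    using \<open>i \<in> {..<n}\<close> by simp
qed

lemma psd_one_mat: "psd_mat n (1\<^sub>m n)"
proof -
  have "quadratic_form n (\<lambda>i j. 1\<^sub>m n $$ (i, j)) x = complex_of_real (\<Sum>i<n. (cmod (x i))\<^sup>2)" for x
    using one_mat_form[of n "\<lambda>i. cnj (x i)" x]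
    unfolding quadratic_form_def of_real_sum complex_norm_square
    by (simp add: mult_ac)
  then show ?thesis
    by (simp add: psd_mat_iff_nonneg_form less_eq_complex_def sum_nonneg)
qed

text \<open>By the arithmetic-geometric mean inequality, the form of the identity matrix is controlled by its
  diagonal values \<open>\<parallel>x\<parallel>\<^sub>2\<^sup>2\<close>.\<close>

lemma vee_norm_one_mat_le:
  assumes "\<And>x. x \<in> carrier_vec n \<Longrightarrow> M x \<le> 1 \<Longrightarrow> (\<Sum>i<n. (cmod (x $ i))\<^sup>2) \<le> c"
    and "M (0\<^sub>v n) \<le> 1"
  shows "vee_norm n M (1\<^sub>m n) \<le> c"
proof (rule vee_norm_le)
  fix x y assume xy: "x \<in> carrier_vec n" "y \<in> carrier_vec n" "M x \<le> 1" "M y \<le> 1"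
  have "cmod (\<Sum>i<n. x $ i * cnj (y $ i))
      \<le> (\<Sum>i<n. ((cmod (x $ i))\<^sup>2 + (cmod (y $ i))\<^sup>2) / 2)"
  proof (rule sum_norm_le)
    fix i
    show "cmod (x $ i * cnj (y $ i)) \<le> ((cmod (x $ i))\<^sup>2 + (cmod (y $ i))\<^sup>2) / 2"
      using sum_squares_bound[of "cmod (x $ i)" "cmod (y $ i)"] by (simp add: norm_mult)
  qed
  also have "\<dots> = ((\<Sum>i<n. (cmod (x $ i))\<^sup>2) + (\<Sum>i<n. (cmod (y $ i))\<^sup>2)) / 2"
    by (simp add: sum.distrib flip: sum_divide_distrib)
  also have "\<dots> \<le> c" using assms(1)[of x] assms(1)[of y] xy by simp
  finally show "cmod (\<Sum>i<n. \<Sum>j<n. 1\<^sub>m n $$ (i, j) * x $ i * cnj (y $ j)) \<le> c"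
    by (simp only: one_mat_form)
qed (rule assms(2))

text \<open>The coordinates are at most one, so lowering the exponent from \<open>2\<close> to \<open>p\<close> increases their powers.\<close>

lemma sum_squares_le_1_if_lp_norm_le_1:
  assumes p: "1 \<le> p" "p \<le> 2" and x: "x \<in> carrier_vec n" "lp_norm p x \<le> 1"
  shows "(\<Sum>i<n. (cmod (x $ i))\<^sup>2) \<le> 1"
proof -
  have le: "cmod (x $ i) \<le> 1" if "i < n" for i
    using lp_ball_coordinatewise_bounded[of p n] p x that
    by (simp add: coordinatewise_bounded_ball_def)
  have "(cmod (x $ i))\<^sup>2 \<le> cmod (x $ i) powr p" if "i < n" for i
  proof (cases "x $ i = 0")
    case False
    have "(cmod (x $ i))\<^sup>2 = cmod (x $ i) powr 2" using False by simp
    also have "\<dots> \<le> cmod (x $ i) powr p"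
      using le[OF that] p False by (intro powr_mono') auto
    finally show ?thesis .
  qed simp
  then have "(\<Sum>i<n. (cmod (x $ i))\<^sup>2) \<le> (\<Sum>i<n. cmod (x $ i) powr p)"
    by (intro sum_mono) auto
  also have "\<dots> \<le> 1" using x p by (simp add: lp_norm_le_1_iff)
  finally show ?thesis .
qed

text \<open>By duality \<open>\<parallel>x\<parallel>\<^sub>2\<^sup>2 \<le> \<parallel>cnj x\<parallel>\<^sub>p\<close>, and the power mean inequality bounds the right-hand side by
  \<open>n\<^bsup>1/p - 1/2\<^esup> \<parallel>x\<parallel>\<^sub>2\<close>. This avoids identifying the dual norm with an \<open>\<ell>\<^sub>q\<close> norm.\<close>

lemma sum_squares_le_if_dual_lp_norm_le_1:
  assumes p: "1 \<le> p" "p \<le> 2" and n: "1 \<le> n"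
    and x: "x \<in> carrier_vec n" "dual_norm n (lp_norm p) x \<le> 1"
  shows "(\<Sum>i<n. (cmod (x $ i))\<^sup>2) \<le> real n powr (2 / p - 1)"
proof (cases "(\<Sum>i<n. (cmod (x $ i))\<^sup>2) = 0")
  case False
  define s where "s = (\<Sum>i<n. (cmod (x $ i))\<^sup>2)"
  have s: "s > 0" using False by (simp add: s_def less_le sum_nonneg)
  \<comment> \<open>The test vector that turns the bilinear pairing with \<open>x\<close> into \<open>\<parallel>x\<parallel>\<^sub>2\<^sup>2\<close>.\<close>
  define z where "z = vec n (\<lambda>i. cnj (x $ i))"
  define L where "L = lp_norm p z"
  have L0: "0 \<le> L" by (simp add: L_def lp_norm_def)
  have Leq: "L = (\<Sum>i<n. cmod (x $ i) powr p) powr (1 / p)" by (simp add: L_def lp_norm_def z_def)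
  have "(\<Sum>i<n. cmod (x $ i) powr p)
      \<le> real n powr (1 - 1 / (2 / p)) * (\<Sum>i<n. (cmod (x $ i) powr p) powr (2 / p)) powr (1 / (2 / p))"
    using p n by (intro power_mean_inequality) auto
  also have "(\<Sum>i<n. (cmod (x $ i) powr p) powr (2 / p)) = s"
    using p unfolding s_def by (intro sum.cong) (auto simp: powr_powr)
  finally have "(\<Sum>i<n. cmod (x $ i) powr p) \<le> real n powr (1 - p / 2) * s powr (p / 2)" by simp
  then have "L \<le> (real n powr (1 - p / 2) * s powr (p / 2)) powr (1 / p)"
    unfolding Leq using p by (intro powr_mono2) (auto simp: sum_nonneg)
  also have "\<dots> = real n powr ((1 - p / 2) * (1 / p)) * s powr (p / 2 * (1 / p))"
    by (simp add: powr_mult powr_powr)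
  also have "\<dots> = real n powr (1 / p - 1 / 2) * sqrt s"
    using p s by (simp add: field_simps flip: powr_half_sqrt)
  finally have L: "L \<le> real n powr (1 / p - 1 / 2) * sqrt s" .
  have "s \<le> L"
  proof -
    have pair: "(\<Sum>i<n. x $ i * z $ i) = complex_of_real s"
      unfolding s_def of_real_sum complex_norm_square by (simp add: z_def)
    \<comment> \<open>If \<open>L\<close> were zero, every multiple of \<open>z\<close> would lie in the unit ball. The multiple by
      \<open>2 / s\<close> pairs to \<open>2\<close> with \<open>x\<close>.\<close>
    have "L \<noteq> 0"
    proof
      assume "L = 0"
      then have "lp_norm p (complex_of_real r \<cdot>\<^sub>v z) \<le> 1" for r
        using p by (simp add: lp_norm_smult L_def)
      then have "cmod (\<Sum>i<n. x $ i * (complex_of_real (2 / s) \<cdot>\<^sub>v z) $ i) \<le> dual_norm n (lp_norm p) x"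
        using p by (intro dual_norm_upper lp_ball_coordinatewise_bounded) (auto simp: z_def simp del: of_real_divide)
      also have "(\<Sum>i<n. x $ i * (complex_of_real (2 / s) \<cdot>\<^sub>v z) $ i) = complex_of_real (2 / s) * (\<Sum>i<n. x $ i * z $ i)"
        unfolding sum_distrib_left by (intro sum.cong) (auto simp: z_def)
      finally show False using x(2) s by (simp add: pair norm_mult)
    qed
    then have L1: "L > 0" using L0 by simp
    have "cmod (\<Sum>i<n. x $ i * (complex_of_real (1 / L) \<cdot>\<^sub>v z) $ i) \<le> dual_norm n (lp_norm p) x"
      using p L1 by (intro dual_norm_upper lp_ball_coordinatewise_bounded)
        (auto simp: z_def lp_norm_smult norm_divide simp flip: L_def[unfolded z_def])
    also have "(\<Sum>i<n. x $ i * (complex_of_real (1 / L) \<cdot>\<^sub>v z) $ i) = complex_of_real (1 / L) * (\<Sum>i<n. x $ i * z $ i)"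
      unfolding sum_distrib_left by (intro sum.cong) (auto simp: z_def)
    finally have "s / L \<le> dual_norm n (lp_norm p) x" using s L1 by (simp add: pair norm_divide)
    then have "s / L \<le> 1" using x(2) by linarith
    then show ?thesis using L1 by simp
  qed
  then have "sqrt s * sqrt s \<le> real n powr (1 / p - 1 / 2) * sqrt s" using L s by simp
  then have "sqrt s \<le> real n powr (1 / p - 1 / 2)"
    by (rule mult_right_le_imp_le) (use s in simp)
  then have "(sqrt s)\<^sup>2 \<le> (real n powr (1 / p - 1 / 2))\<^sup>2" using s by (intro power_mono) auto
  also have "\<dots> = real n powr (2 / p - 1)"
    using n powr_power[of "real n" "1 / p - 1 / 2" 2] by (simp add: algebra_simps)
  finally show ?thesis using s by (simp add: s_def)
qed simp

text \<open>The test matrices are \<open>A = B = I\<close>, with \<open>\<Sum> a\<^sub>i\<^sub>j b\<^sub>i\<^sub>j = n\<close>.\<close>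

lemma gamma_const_lp_lower:
  assumes p: "1 \<le> p" "p \<le> 2" and n: "1 \<le> n"
  shows "ereal (real n powr (2 * (1 - 1 / p))) \<le> gamma_const n (lp_norm p)"
  unfolding gamma_const_def
proof (rule Inf_greatest, clarify)
  fix c assume c: "\<forall>A B. psd_mat n A \<longrightarrow> psd_mat n B \<longrightarrow>
     Re (\<Sum>i<n. \<Sum>j<n. A $$ (i, j) * B $$ (i, j))
       \<le> c * vee_norm n (dual_norm n (lp_norm p)) A * vee_norm n (lp_norm p) B"
  have p0: "0 < p" using p by simp
  note ball = lp_ball_coordinatewise_bounded[OF p0, of n] lp_norm_zero[OF p0, of n]
  note dball = dual_lp_ball_coordinatewise_bounded[OF p0, of n] dual_norm_zero[of "lp_norm p" n, OF ball(2)]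
  define a where "a = vee_norm n (dual_norm n (lp_norm p)) (1\<^sub>m n)"
  define b where "b = vee_norm n (lp_norm p) (1\<^sub>m n)"
  have a: "0 \<le> a" "a \<le> real n powr (2 / p - 1)"
  proof -
    show "0 \<le> a" unfolding a_def by (rule vee_norm_nonneg[OF dball])
    show "a \<le> real n powr (2 / p - 1)"
      unfolding a_def
      using sum_squares_le_if_dual_lp_norm_le_1[OF p n] dball(2) by (rule vee_norm_one_mat_le)
  qed
  have b: "0 \<le> b" "b \<le> 1"
  proof -
    show "0 \<le> b" unfolding b_def by (rule vee_norm_nonneg[OF ball])
    show "b \<le> 1"
      unfolding b_def
      using sum_squares_le_1_if_lp_norm_le_1[OF p] ball(2) by (rule vee_norm_one_mat_le)
  qed
  have "(\<Sum>i<n. \<Sum>j<n. 1\<^sub>m n $$ (i, j) * 1\<^sub>m n $$ (i, j)) = (\<Sum>i<n. \<Sum>j<n. 1\<^sub>m n $$ (i, j) * 1 * (1::complex))"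
    by (intro sum.cong) auto
  also have "\<dots> = of_nat n" by (subst one_mat_form) simp
  finally have "real n \<le> c * (a * b)"
    using c[rule_format, OF psd_one_mat psd_one_mat]
    unfolding a_def b_def by (simp only: complex_Re_of_nat mult.assoc)
  moreover have ab: "0 \<le> a * b" "a * b \<le> real n powr (2 / p - 1)"
    using a b mult_left_le[OF b(2) a(1)] by auto
  ultimately have "0 \<le> c" using n by (smt (verit) mult_nonpos_nonneg of_nat_1 of_nat_le_iff)
  then have "real n \<le> c * real n powr (2 / p - 1)"
    using \<open>real n \<le> c * (a * b)\<close> ab(2) by (meson mult_left_mono order_trans)
  then have "real n / real n powr (2 / p - 1) \<le> c"
    using n by (simp add: pos_divide_le_eq)
  also have "real n / real n powr (2 / p - 1) = real n powr (1 - (2 / p - 1))"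
    using n by (simp add: powr_diff power2_eq_square)
  finally show "ereal (real n powr (2 * (1 - 1 / p))) \<le> ereal c" by (simp add: algebra_simps)
qed

section \<open>The upper bound\<close>

lemma sum_cmod_le_lp:
  assumes "1 \<le> p" "1 \<le> n" "z \<in> carrier_vec n" "lp_norm p z \<le> 1"
  shows "(\<Sum>i<n. cmod (z $ i)) \<le> real n powr (1 - 1 / p)"
proof -
  have "(\<Sum>i<n. cmod (z $ i))
      \<le> real n powr (1 - 1 / p) * (\<Sum>i<n. cmod (z $ i) powr p) powr (1 / p)"
    using assms by (intro power_mean_inequality) auto
  also have "\<dots> = real n powr (1 - 1 / p) * lp_norm p z"
    using assms by (simp add: lp_norm_def)
  also have "\<dots> \<le> real n powr (1 - 1 / p)"
    using assms by (intro mult_left_le) auto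
  finally show ?thesis .
qed

text \<open>In terms of the conjugate exponent: \<open>\<parallel>x\<parallel>\<^sub>q \<le> n\<^bsup>1/q\<^esup> \<parallel>x\<parallel>\<^sub>\<infinity>\<close> where \<open>1/q = 1 - 1/p\<close>.\<close>

lemma dual_lp_norm_le_linf:
  assumes "1 \<le> p" "1 \<le> n" "\<And>i. i < n \<Longrightarrow> cmod (x $ i) \<le> c"
  shows "dual_norm n (lp_norm p) x \<le> c * real n powr (1 - 1 / p)"
proof (rule dual_norm_le)
  have c: "0 \<le> c" using assms(2) assms(3)[of 0] norm_ge_zero[of "x $ 0"] by linarith
  fix z assume z: "z \<in> carrier_vec n" "lp_norm p z \<le> 1"
  have "cmod (\<Sum>j<n. x $ j * z $ j) \<le> (\<Sum>j<n. c * cmod (z $ j))"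
    using assms(3) by (intro sum_norm_le) (auto simp: norm_mult intro!: mult_right_mono)
  also have "\<dots> \<le> c * real n powr (1 - 1 / p)"
    using sum_cmod_le_lp[OF assms(1,2) z] c by (simp add: mult_left_mono flip: sum_distrib_left)
  finally show "cmod (\<Sum>j<n. x $ j * z $ j) \<le> c * real n powr (1 - 1 / p)" .
qed (use assms in \<open>simp add: lp_norm_zero\<close>)

text \<open>The \<open>\<ell>\<^sub>1\<close> norm of \<open>A x\<close> is a value of the form of \<open>A\<close> at \<open>x\<close> and a vector of phases, both in the unit
  ball of \<open>\<ell>\<^sub>\<infinity>\<close>. That ball lies in the dual ball of \<open>\<ell>\<^sub>p\<close> enlarged by \<open>n\<^bsup>1 - 1/p\<^esup>\<close>, and the
  factor occurs once for each of the two arguments.\<close>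

lemma opnorm_inf_1_le_vee_norm:
  assumes p: "1 \<le> p" and n: "1 \<le> n" and A: "A \<in> carrier_mat n n"
  shows "opnorm_inf_1 n A \<le> real n powr (2 * (1 - 1 / p)) * vee_norm n (dual_norm n (lp_norm p)) A"
  unfolding opnorm_inf_1_def
proof (rule cSup_least)
  have "linf_norm (0\<^sub>v n) \<le> 1" using n by (rule linf_norm_zero)
  then show "{lp_norm 1 (A *\<^sub>v x) |x. x \<in> carrier_vec n \<and> linf_norm x \<le> 1} \<noteq> {}"
    using zero_carrier_vec[of n] by blast
  fix r assume "r \<in> {lp_norm 1 (A *\<^sub>v x) |x. x \<in> carrier_vec n \<and> linf_norm x \<le> 1}"
  then obtain x where r: "r = lp_norm 1 (A *\<^sub>v x)" and x: "x \<in> carrier_vec n" "linf_norm x \<le> 1"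
    by blast
  have xi: "\<And>i. i < n \<Longrightarrow> cmod (x $ i) \<le> 1" using x n by (simp add: linf_norm_le_1_iff)
  define \<kappa> where "\<kappa> = real n powr (1 - 1 / p)"
  have \<kappa>: "\<kappa> > 0" using n by (simp add: \<kappa>_def)
  obtain s where s: "\<And>i. cmod (s i) \<le> 1"
      "\<And>i. s i * (A *\<^sub>v x) $ i = complex_of_real (cmod ((A *\<^sub>v x) $ i))"
    using unimodular_multipliers[of "\<lambda>i. (A *\<^sub>v x) $ i"] by blast
  \<comment> \<open>Both vectors are scaled into the unit ball of the dual norm. The conjugate in \<open>Y\<close> cancels
    the one in the sesquilinear form.\<close>
  define X where "X = vec n (\<lambda>i. s i / \<kappa>)"
  define Y where "Y = vec n (\<lambda>i. cnj (x $ i) / \<kappa>)"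
  have X: "dual_norm n (lp_norm p) X \<le> 1"
    using dual_lp_norm_le_linf[OF p n, of X "1 / \<kappa>"] s(1) \<kappa>
    by (simp add: X_def norm_divide divide_right_mono flip: \<kappa>_def)
  have Y: "dual_norm n (lp_norm p) Y \<le> 1"
    using dual_lp_norm_le_linf[OF p n, of Y "1 / \<kappa>"] xi \<kappa>
    by (simp add: Y_def norm_divide divide_right_mono flip: \<kappa>_def)
  have Ax: "(A *\<^sub>v x) $ i = (\<Sum>j<n. A $$ (i, j) * x $ j)" if "i < n" for i
    using A x that by (auto simp: scalar_prod_def lessThan_atLeast0 intro!: sum.cong)
  have "(\<Sum>i<n. \<Sum>j<n. A $$ (i, j) * X $ i * cnj (Y $ j))
      = (\<Sum>i<n. s i * (A *\<^sub>v x) $ i) / complex_of_real (\<kappa>\<^sup>2)"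
    unfolding sum_divide_distrib
    by (intro sum.cong refl)
      (auto simp: Ax X_def Y_def sum_distrib_left sum_divide_distrib power2_eq_square mult_ac intro!: sum.cong)
  also have "\<dots> = complex_of_real (r / \<kappa>\<^sup>2)"
    unfolding s(2) r using A by (simp add: lp_norm_def sum_nonneg del: index_mult_mat_vec)
  finally have "cmod (complex_of_real (r / \<kappa>\<^sup>2)) \<le> vee_norm n (dual_norm n (lp_norm p)) A"
    using vee_norm_upper[OF dual_lp_ball_coordinatewise_bounded, of p X n Y A] p X Y
    by (simp add: X_def Y_def)
  then have "r / \<kappa>\<^sup>2 \<le> vee_norm n (dual_norm n (lp_norm p)) A" by (simp only: norm_of_real abs_le_iff)
  then have "r \<le> \<kappa>\<^sup>2 * vee_norm n (dual_norm n (lp_norm p)) A"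
    using \<kappa> by (simp add: pos_divide_le_eq mult.commute)
  also have "\<kappa>\<^sup>2 = real n powr (2 * (1 - 1 / p))"
    unfolding \<kappa>_def using powr_power[of "real n" "1 - 1 / p" 2] n by simp
  finally show "r \<le> real n powr (2 * (1 - 1 / p)) * vee_norm n (dual_norm n (lp_norm p)) A" .
qed

text \<open>Scaling reduces this to \<open>trace_pairing_le_KG_plus\<close>. The diagonal entries of \<open>B\<close> are values of its
  form at unit vectors, hence at most \<open>vee_norm n (lp_norm p) B\<close>, and \<open>opnorm_inf_1_le_vee_norm\<close>
  takes care of \<open>A\<close>.\<close>

lemma trace_pairing_le_vee_norms:
  assumes p: "1 \<le> p" and n: "1 \<le> n" and A: "psd_mat n A" and B: "psd_mat n B"
    and K: "KG_plus = ereal K"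
  shows "Re (\<Sum>i<n. \<Sum>j<n. A $$ (i, j) * B $$ (i, j))
    \<le> K * real n powr (2 * (1 - 1 / p)) * vee_norm n (dual_norm n (lp_norm p)) A * vee_norm n (lp_norm p) B"
proof -
  define \<alpha> where "\<alpha> = real n powr (2 * (1 - 1 / p)) * vee_norm n (dual_norm n (lp_norm p)) A"
  define \<beta> where "\<beta> = vee_norm n (lp_norm p) B"
  define S where "S = (\<Sum>i<n. \<Sum>j<n. A $$ (i, j) * B $$ (i, j))"
  have p0: "0 < p" using p by simp
  have Ac: "A \<in> carrier_mat n n" and Bc: "B \<in> carrier_mat n n"
    using A B by (simp_all add: psd_mat_def)
  note ball = lp_ball_coordinatewise_bounded[OF p0, of n] lp_norm_zero[OF p0, of n]
  note dball = dual_lp_ball_coordinatewise_bounded[OF p0, of n] dual_norm_zero[of "lp_norm p" n, OF ball(2)]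
  have \<alpha>: "0 \<le> \<alpha>" using vee_norm_nonneg[OF dball] by (simp add: \<alpha>_def)
  have \<beta>: "0 \<le> \<beta>" using vee_norm_nonneg[OF ball] by (simp add: \<beta>_def)
  have diag: "Re (B $$ (i, i)) \<le> \<beta>" if i: "i < n" for i
  proof -
    have "lp_norm p (unit_vec n i) \<le> 1"
      using p0 i by (rule lp_norm_unit_vec)
    then have "cmod (\<Sum>k<n. \<Sum>l<n. B $$ (k, l) * unit_vec n i $ k * cnj (unit_vec n i $ l)) \<le> \<beta>"
      unfolding \<beta>_def by (intro vee_norm_upper ball) auto
    also have "(\<Sum>k<n. \<Sum>l<n. B $$ (k, l) * unit_vec n i $ k * cnj (unit_vec n i $ l))
        = quadratic_form n (\<lambda>l k. B $$ (k, l)) (\<lambda>k. if k = i then 1 else 0)"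
      unfolding quadratic_form_def using i by (subst sum.swap) (auto intro!: sum.cong)
    also have "\<dots> = B $$ (i, i)" using i by (rule quadratic_form_unit)
    finally show ?thesis using complex_Re_le_cmod order_trans by blast
  qed
  \<comment> \<open>The norms of \<open>A\<close> and \<open>B\<close> may vanish, hence the normalisation by slightly larger numbers.\<close>
  have "Re S \<le> K * (\<alpha> + \<epsilon>) * (\<beta> + \<epsilon>)" if \<epsilon>: "\<epsilon> > 0" for \<epsilon>
  proof -
    define A' where "A' = complex_of_real (1 / (\<alpha> + \<epsilon>)) \<cdot>\<^sub>m A"
    define B' where "B' = complex_of_real (1 / (\<beta> + \<epsilon>)) \<cdot>\<^sub>m B"
    have psd: "psd_mat n A'" "psd_mat n B'"
      unfolding A'_def B'_def using A B \<alpha> \<beta> \<epsilon> by (auto intro!: psd_mat_smult simp del: of_real_divide)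
    have "opnorm_inf_1 n A' \<le> real n powr (2 * (1 - 1 / p)) * vee_norm n (dual_norm n (lp_norm p)) A'"
      using p n psd by (intro opnorm_inf_1_le_vee_norm) (auto simp: psd_mat_def)
    also have "\<dots> \<le> real n powr (2 * (1 - 1 / p)) * (1 / (\<alpha> + \<epsilon>) * vee_norm n (dual_norm n (lp_norm p)) A)"
      unfolding A'_def using \<alpha> \<epsilon> by (intro mult_left_mono vee_norm_smult_le dball Ac) auto
    also have "\<dots> = \<alpha> / (\<alpha> + \<epsilon>)" by (simp add: \<alpha>_def)
    also have "\<dots> \<le> 1" using \<alpha> \<epsilon> by simp
    finally have op: "opnorm_inf_1 n A' \<le> 1" .
    have dg: "Re (B' $$ (i, i)) \<le> 1" if "i < n" for i
      using diag[OF that] \<beta> \<epsilon> Bc that by (simp add: B'_def)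
    have "(\<Sum>i<n. \<Sum>j<n. A' $$ (i, j) * B' $$ (i, j))
        = complex_of_real (1 / ((\<alpha> + \<epsilon>) * (\<beta> + \<epsilon>))) * S"
      unfolding S_def A'_def B'_def sum_distrib_left using Ac Bc by (intro sum.cong) auto
    moreover have "ereal (Re (\<Sum>i<n. \<Sum>j<n. A' $$ (i, j) * B' $$ (i, j))) \<le> ereal K"
      using trace_pairing_le_KG_plus[OF n psd(1) op psd(2) dg] K by simp
    ultimately have "Re S / ((\<alpha> + \<epsilon>) * (\<beta> + \<epsilon>)) \<le> K" by simp
    moreover have "(\<alpha> + \<epsilon>) * (\<beta> + \<epsilon>) > 0" using \<alpha> \<beta> \<epsilon> by simp
    ultimately show ?thesis by (simp add: pos_divide_le_eq mult.assoc)
  qed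
  moreover have "((\<lambda>\<epsilon>. K * (\<alpha> + \<epsilon>) * (\<beta> + \<epsilon>)) \<longlongrightarrow> K * \<alpha> * \<beta>) (at_right 0)"
    by (auto intro!: tendsto_eq_intros)
  ultimately have "Re S \<le> K * \<alpha> * \<beta>"
    by (intro tendsto_lowerbound[where F = "at_right 0"]) (auto simp: eventually_at_right_less eventually_at_filter)
  then show ?thesis by (simp add: S_def \<alpha>_def \<beta>_def mult.assoc)
qed

text \<open>If the Grothendieck constant is infinite, so is the right-hand side, because the power of \<open>n\<close> is
  positive.\<close>

lemma gamma_const_lp_upper:
  assumes p: "1 \<le> p" and n: "1 \<le> n"
  shows "gamma_const n (lp_norm p) \<le> KG_plus * ereal (real n powr (2 * (1 - 1 / p)))"
proof (cases KG_plus)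
  case (real K)
  have "gamma_const n (lp_norm p) \<le> ereal (K * real n powr (2 * (1 - 1 / p)))"
    unfolding gamma_const_def
    using trace_pairing_le_vee_norms[OF p n _ _ real] by (intro Inf_lower imageI CollectI) auto
  then show ?thesis by (simp add: real)
next
  case PInf
  then show ?thesis using n by simp
next
  case MInf
  then show ?thesis using KG_plus_nonneg by simp
qed

theorem proposition6p2:
  fixes p :: real and p' :: ereal and n :: nat
  assumes "1 \<le> p" and "p \<le> 2" and "1 / ereal p + 1 / p' = 1" and "1 \<le> n"
  shows "ereal (real n powr real_of_ereal (2 / p')) \<le> gamma_const n (lp_norm p) \<and>
         gamma_const n (lp_norm p) \<le> KG_plus * ereal (real n powr real_of_ereal (2 / p'))"
proof -
  have "real_of_ereal (2 / p') = 2 * (1 - 1 / p)"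
  proof (cases p')
    case (real r)
    have "r \<noteq> 0" using assms(1,3) real by (auto simp: divide_ereal_def)
    then have "1 / r = 1 - 1 / p" using assms(1,3) real by (simp add: one_ereal_def)
    moreover have "real_of_ereal (2 / p') = 2 * (1 / r)" using \<open>r \<noteq> 0\<close> real by simp
    ultimately show ?thesis by simp
  qed (use assms(1,3) in \<open>simp_all add: one_ereal_def\<close>)
  then show ?thesis
    using gamma_const_lp_lower gamma_const_lp_upper assms by simp
qed

end
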